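(* Let $\theta_0\in[1,2)$ and $\delta>0$. For a vector $w$ with positive coordinates, let $\min w$ denote its smallest coordinate and define $$\Theta^*(w)=\sup\{\omega\in[1,2]\;:\;\varphi_\omega(\min w)\ge 0\},\qquad \Theta(w)=\min\big(\max(1,\Theta^*(w)-\delta),\theta_0\big).$$ Then, for each $k\in\{1,2\}$, the function $\Theta_k:\mathbb{R}_{+*}^{n_1n_2}\to\mathbb{R}$ given by $$\Theta_k(\gamma)=\Theta\big((A_k\gamma)\oslash\mu_k\big)$$ is continuous and satisfies the descent condition $$\forall\gamma\in\mathbb{R}_{+*}^{n_1n_2},\qquad F\big(P_{\mathcal{C}_k}^{\Theta_k(\gamma)}(\gamma)\big)\le F(\gamma),$$ where the inequality is strict whenever $\gamma\notin\mathcal{C}_k$.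
   Context: Let $\mathbb{R}_+=[0,\infty)$ and $\mathbb{R}_{+*}=(0,\infty)$. Let $n_1,n_2\ge 1$ be integers, let $\mu_1\in\mathbb{R}_{+*}^{n_1}$ and $\mu_2\in\mathbb{R}_{+*}^{n_2}$ be discrete probability measures (positive entries summing to $1$), let $c\in\mathbb{R}_+^{n_1\times n_2}$ be a cost matrix, and let $\varepsilon>0$. Elements of $\mathbb{R}^{n_1n_2}$ are viewed as $n_1\times n_2$ matrices. Define the linear maps $(A_1x)_i=\sum_j x_{i,j}$ (row sums, with values in $\mathbb{R}^{n_1}$) and $(A_2x)_j=\sum_i x_{i,j}$ (column sums, with values in $\mathbb{R}^{n_2}$), and $\mathcal{C}_k=\{\gamma\in\mathbb{R}^{n_1n_2}: A_k\gamma=\mu_k\}$ for $k=1,2$. The symbol $\oslash$ denotes coordinatewise division. Kullback–Leibler divergence: $\mathrm{KL}(\gamma,\zeta)=\sum_{i,j}\gamma_{i,j}\big(\log(\gamma_{i,j}/\zeta_{i,j})-1\big)+\sum_{i,j}\zeta_{i,j}$, with $0\log 0=0$. The matrix $\gamma^*$ is the unique minimizer of $\gamma\mapsto\sum_{i,j}c_{i,j}\gamma_{i,j}+\varepsilon\,\mathrm{KL}(\gamma,\mathbf{1})$ over $\mathcal{C}_1\cap\mathcal{C}_2\cap\mathbb{R}_+^{n_1n_2}$, where $\mathbf{1}$ is the all-ones matrix. Lyapunov function: $F(\gamma)=\mathrm{KL}(\gamma^*,\gamma)$. Bregman projections of $\gamma\in\mathbb{R}_{+*}^{n_1n_2}$: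 $P_{\mathcal{C}_1}(\gamma)_{i,j}=\frac{(\mu_1)_i}{(A_1\gamma)_i}\gamma_{i,j}$ and $P_{\mathcal{C}_2}(\gamma)_{i,j}=\gamma_{i,j}\frac{(\mu_2)_j}{(A_2\gamma)_j}$. For $\omega\ge 0$, the $\omega$-relaxed projection $P^\omega_{\mathcal{C}_k}$ is defined by $\log P^\omega_{\mathcal{C}_k}(\gamma)=(1-\omega)\log\gamma+\omega\log P_{\mathcal{C}_k}(\gamma)$, with the logarithm taken entrywise. For $\omega\ge 0$ and $x>0$: $\varphi_\omega(x)=x(1-x^{-\omega})-\omega\log x$. *)

theory Defs
  imports "HOL-Analysis.Analysis" "HOL-Real_Asymp.Real_Asymp"
begin

text \<open>
  Vectors of length \<open>n\<^sub>1\<close> and \<open>n\<^sub>2\<close> are indexed by the finite types \<open>'n\<close> and \<open>'m\<close>, and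
  \<open>n\<^sub>1 \<times> n\<^sub>2\<close> matrices are elements of \<^typ>\<open>real^'m^'n\<close>: \<open>\<gamma> $ i $ j\<close> is the entry in row \<open>i\<close>
  and column \<open>j\<close>.
\<close>

definition vec_divide :: "real^'n \<Rightarrow> real^'n \<Rightarrow> real^'n"  (infixl "\<oslash>" 70) where
  "v \<oslash> w = (\<chi> i. v $ i / w $ i)"

definition row_sums :: "real^'m^'n \<Rightarrow> real^'n" where
  "row_sums x = (\<chi> i. \<Sum>j\<in>UNIV. x $ i $ j)"

definition col_sums :: "real^'m^'n \<Rightarrow> real^'m" where
  "col_sums x = (\<chi> j. \<Sum>i\<in>UNIV. x $ i $ j)"

definition row_constraint :: "real^'n \<Rightarrow> (real^'m^'n) set" where
  "row_constraint \<mu>\<^sub>1 = {\<gamma>. row_sums \<gamma> = \<mu>\<^sub>1}"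

definition col_constraint :: "real^'m \<Rightarrow> (real^'m^'n) set" where
  "col_constraint \<mu>\<^sub>2 = {\<gamma>. col_sums \<gamma> = \<mu>\<^sub>2}"

definition prob_vec :: "real^'n \<Rightarrow> bool" where
  "prob_vec \<mu> \<longleftrightarrow> (\<forall>i. 0 < \<mu> $ i) \<and> (\<Sum>i\<in>UNIV. \<mu> $ i) = 1"

definition nonneg_mats :: "(real^'m^'n) set" where
  "nonneg_mats = {\<gamma>. \<forall>i j. 0 \<le> \<gamma> $ i $ j}"

definition pos_mats :: "(real^'m^'n) set" where
  "pos_mats = {\<gamma>. \<forall>i j. 0 < \<gamma> $ i $ j}"

text \<open>
  The convention \<open>0 log 0 = 0\<close> holds automatically, since \<open>ln 0\<close> is a real number.
  The divergence is only used for \<open>\<gamma> \<in> nonneg_mats\<close> and \<open>\<zeta> \<in> pos_mats\<close>.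
\<close>

definition KL :: "real^'m^'n \<Rightarrow> real^'m^'n \<Rightarrow> real" where
  "KL \<gamma> \<zeta> =
     (\<Sum>i\<in>UNIV. \<Sum>j\<in>UNIV. \<gamma> $ i $ j * (ln (\<gamma> $ i $ j / \<zeta> $ i $ j) - 1))
     + (\<Sum>i\<in>UNIV. \<Sum>j\<in>UNIV. \<zeta> $ i $ j)"

definition entropic_cost :: "real^'m^'n \<Rightarrow> real \<Rightarrow> real^'m^'n \<Rightarrow> real" where
  "entropic_cost c \<epsilon> \<gamma> =
     (\<Sum>i\<in>UNIV. \<Sum>j\<in>UNIV. c $ i $ j * \<gamma> $ i $ j) + \<epsilon> * KL \<gamma> (\<chi> i j. 1)"

definition is_optimal_plan ::
    "real^'m^'n \<Rightarrow> real \<Rightarrow> real^'n \<Rightarrow> real^'m \<Rightarrow> real^'m^'n \<Rightarrow> bool" where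
  "is_optimal_plan c \<epsilon> \<mu>\<^sub>1 \<mu>\<^sub>2 \<gamma> \<longleftrightarrow>
     is_arg_min (entropic_cost c \<epsilon>)
       (\<lambda>\<gamma>. \<gamma> \<in> row_constraint \<mu>\<^sub>1 \<inter> col_constraint \<mu>\<^sub>2 \<inter> nonneg_mats) \<gamma>"

text \<open>The matrix \<open>\<gamma>\<^sup>*\<close>; it is well defined by \<open>ex1_optimal_plan\<close> below.\<close>

definition optimal_plan ::
    "real^'m^'n \<Rightarrow> real \<Rightarrow> real^'n \<Rightarrow> real^'m \<Rightarrow> real^'m^'n" where
  "optimal_plan c \<epsilon> \<mu>\<^sub>1 \<mu>\<^sub>2 = (THE \<gamma>. is_optimal_plan c \<epsilon> \<mu>\<^sub>1 \<mu>\<^sub>2 \<gamma>)"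

definition lyapunov ::
    "real^'m^'n \<Rightarrow> real \<Rightarrow> real^'n \<Rightarrow> real^'m \<Rightarrow> real^'m^'n \<Rightarrow> real" where
  "lyapunov c \<epsilon> \<mu>\<^sub>1 \<mu>\<^sub>2 \<gamma> = KL (optimal_plan c \<epsilon> \<mu>\<^sub>1 \<mu>\<^sub>2) \<gamma>"

definition row_proj :: "real^'n \<Rightarrow> real^'m^'n \<Rightarrow> real^'m^'n" where
  "row_proj \<mu>\<^sub>1 \<gamma> = (\<chi> i j. \<mu>\<^sub>1 $ i / row_sums \<gamma> $ i * \<gamma> $ i $ j)"

definition col_proj :: "real^'m \<Rightarrow> real^'m^'n \<Rightarrow> real^'m^'n" where
  "col_proj \<mu>\<^sub>2 \<gamma> = (\<chi> i j. \<gamma> $ i $ j * (\<mu>\<^sub>2 $ j / col_sums \<gamma> $ j))"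

text \<open>
  \<open>relaxed P \<omega>\<close> is the \<open>\<omega>\<close>-relaxation \<open>P\<^sup>\<omega>\<close> of \<open>P\<close>, given by
  \<open>log P\<^sup>\<omega>(\<gamma>) = (1 - \<omega>) log \<gamma> + \<omega> log P(\<gamma>)\<close> entrywise.
\<close>

definition relaxed ::
    "(real^'m^'n \<Rightarrow> real^'m^'n) \<Rightarrow> real \<Rightarrow> real^'m^'n \<Rightarrow> real^'m^'n" where
  "relaxed P \<omega> \<gamma> = (\<chi> i j. exp ((1 - \<omega>) * ln (\<gamma> $ i $ j) + \<omega> * ln (P \<gamma> $ i $ j)))"

definition \<phi> :: "real \<Rightarrow> real \<Rightarrow> real" where
  "\<phi> \<omega> x = x * (1 - x powr (- \<omega>)) - \<omega> * ln x"

definition min_coord :: "real^'n \<Rightarrow> real" where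
  "min_coord w = Min (range (($) w))"

definition Theta_star :: "real^'n \<Rightarrow> real" where
  "Theta_star w = Sup {\<omega> \<in> {1..2}. 0 \<le> \<phi> \<omega> (min_coord w)}"

definition Theta :: "real \<Rightarrow> real \<Rightarrow> real^'n \<Rightarrow> real" where
  "Theta \<theta>\<^sub>0 \<delta> w = min (max 1 (Theta_star w - \<delta>)) \<theta>\<^sub>0"

definition row_Theta :: "real \<Rightarrow> real \<Rightarrow> real^'n \<Rightarrow> real^'m^'n \<Rightarrow> real" where
  "row_Theta \<theta>\<^sub>0 \<delta> \<mu>\<^sub>1 \<gamma> = Theta \<theta>\<^sub>0 \<delta> (row_sums \<gamma> \<oslash> \<mu>\<^sub>1)"

definition col_Theta :: "real \<Rightarrow> real \<Rightarrow> real^'m \<Rightarrow> real^'m^'n \<Rightarrow> real" where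
  "col_Theta \<theta>\<^sub>0 \<delta> \<mu>\<^sub>2 \<gamma> = Theta \<theta>\<^sub>0 \<delta> (col_sums \<gamma> \<oslash> \<mu>\<^sub>2)"


subsection \<open>Well-definedness of the optimal plan\<close>

lemma xlnx_tangent:
  fixes x m :: real
  assumes "0 \<le> x" "0 < m"
  shows "x * ln m + x - m \<le> x * ln x" and "x \<noteq> m \<Longrightarrow> x * ln m + x - m < x * ln x"
proof -
  have *: "x * ln m + x - m \<le> x * ln x \<and> (x \<noteq> m \<longrightarrow> x * ln m + x - m < x * ln x)"
  proof (cases "x = 0")
    case True
    then show ?thesis using assms by simp
  next
    case False
    then have x: "0 < x" using assms by simp
    have l: "ln (m / x) = ln m - ln x" using x assms by (simp add: ln_div)
    have 1: "ln (m / x) \<le> m / x - 1"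
      using ln_le_minus_one[of "m / x"] x assms by simp
    have "ln (m / x) \<noteq> m / x - 1" if "x \<noteq> m"
      using ln_eq_minus_one[of "m / x"] x assms that by auto
    then have 2: "ln (m / x) < m / x - 1" if "x \<noteq> m"
      using 1 that by fastforce
    show ?thesis
      using 1 2 x unfolding l by (auto simp: field_simps)
  qed
  show "x * ln m + x - m \<le> x * ln x" "x \<noteq> m \<Longrightarrow> x * ln m + x - m < x * ln x"
    using * by auto
qed

lemma xlnx_midpoint:
  fixes x y :: real
  assumes "0 \<le> x" "0 \<le> y"
  shows "2 * ((x + y) / 2 * ln ((x + y) / 2)) \<le> x * ln x + y * ln y"
    and "x \<noteq> y \<Longrightarrow> 2 * ((x + y) / 2 * ln ((x + y) / 2)) < x * ln x + y * ln y"
proof -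
  define m where "m = (x + y) / 2"
  have y: "y = 2 * m - x" by (simp add: m_def field_simps)
  have *: "2 * (m * ln m) \<le> x * ln x + y * ln y \<and>
           (x \<noteq> y \<longrightarrow> 2 * (m * ln m) < x * ln x + y * ln y)"
  proof (cases "m = 0")
    case True
    then have "x = 0 \<and> y = 0" using assms by (auto simp: m_def)
    then show ?thesis using True by simp
  next
    case False
    then have m: "0 < m" using assms by (auto simp: m_def)
    have e: "(x * ln m + x - m) + (y * ln m + y - m) = 2 * (m * ln m)"
      unfolding y by (simp add: algebra_simps)
    have "x \<noteq> m" if "x \<noteq> y" using that by (auto simp: m_def)
    then show ?thesis
      using xlnx_tangent[OF assms(1) m] xlnx_tangent(1)[OF assms(2) m] e by force
  qed
  show "2 * ((x + y) / 2 * ln ((x + y) / 2)) \<le> x * ln x + y * ln y"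
    and "x \<noteq> y \<Longrightarrow> 2 * ((x + y) / 2 * ln ((x + y) / 2)) < x * ln x + y * ln y"
    using * by (auto simp: m_def)
qed

lemma continuous_on_xlnx: "continuous_on {0..} (\<lambda>x::real. x * ln x)"
proof (unfold continuous_on_eq_continuous_within, intro ballI)
  fix x :: real assume "x \<in> {0..}"
  show "continuous (at x within {0..}) (\<lambda>x. x * ln x)"
  proof (cases "x = 0")
    case True
    have "((\<lambda>x::real. x * ln x) \<longlongrightarrow> 0) (at_right 0)" by real_asymp
    moreover have "at 0 within {0..} = at_right (0::real)"
      unfolding at_within_def by (rule arg_cong[where f = "\<lambda>A. inf (nhds 0) (principal A)"]) auto
    ultimately show ?thesis
      using True by (simp add: continuous_within)
  next
    case False
    then show ?thesis using \<open>x \<in> {0..}\<close> by (intro continuous_intros) auto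
  qed
qed

lemma entropic_cost_altdef:
  fixes c \<gamma> :: "real^'m^'n"
  shows "entropic_cost c \<epsilon> \<gamma> =
    (\<Sum>i\<in>UNIV. \<Sum>j\<in>UNIV. (c $ i $ j - \<epsilon>) * \<gamma> $ i $ j + \<epsilon> * (\<gamma> $ i $ j * ln (\<gamma> $ i $ j) + 1))"
  unfolding entropic_cost_def KL_def
  by (simp add: sum.distrib sum_distrib_left algebra_simps sum_subtractf)

lemma ex1_optimal_plan:
  fixes c :: "real^'m^'n"
  assumes eps: "0 < \<epsilon>" and mu1: "prob_vec \<mu>\<^sub>1" and mu2: "prob_vec \<mu>\<^sub>2"
  shows "\<exists>!\<gamma>. is_optimal_plan c \<epsilon> \<mu>\<^sub>1 \<mu>\<^sub>2 \<gamma>"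
proof -
  define S :: "(real^'m^'n) set"
    where "S = row_constraint \<mu>\<^sub>1 \<inter> col_constraint \<mu>\<^sub>2 \<inter> nonneg_mats"
  have S_iff: "\<gamma> \<in> S \<longleftrightarrow> (\<forall>i. (\<Sum>j\<in>UNIV. \<gamma> $ i $ j) = \<mu>\<^sub>1 $ i) \<and>
      (\<forall>j. (\<Sum>i\<in>UNIV. \<gamma> $ i $ j) = \<mu>\<^sub>2 $ j) \<and> (\<forall>i j. 0 \<le> \<gamma> $ i $ j)" for \<gamma>
    by (auto simp: S_def row_constraint_def col_constraint_def nonneg_mats_def
        row_sums_def col_sums_def vec_eq_iff)
  have opt_iff: "is_optimal_plan c \<epsilon> \<mu>\<^sub>1 \<mu>\<^sub>2 \<gamma> \<longleftrightarrow>
      \<gamma> \<in> S \<and> (\<forall>\<eta>\<in>S. entropic_cost c \<epsilon> \<gamma> \<le> entropic_cost c \<epsilon> \<eta>)" for \<gamma>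
    unfolding is_optimal_plan_def S_def[symmetric] is_arg_min_def
    by (auto simp: not_less)
  have ne: "(\<chi> i j. \<mu>\<^sub>1 $ i * \<mu>\<^sub>2 $ j) \<in> S"
    using mu1 mu2
    by (auto simp: S_iff prob_vec_def sum_distrib_left[symmetric] sum_distrib_right[symmetric]
        intro!: mult_nonneg_nonneg less_imp_le)
  have bd: "bounded S"
  proof (rule boundedI)
    fix \<gamma> assume g: "\<gamma> \<in> S"
    have "norm \<gamma> \<le> (\<Sum>i\<in>UNIV. norm (\<gamma> $ i))"
      by (simp add: norm_vec_def L2_set_le_sum)
    also have "\<dots> \<le> (\<Sum>i\<in>UNIV. \<Sum>j\<in>UNIV. norm (\<gamma> $ i $ j))"
      by (intro sum_mono) (simp add: norm_vec_def L2_set_le_sum)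
    also have "\<dots> = (\<Sum>i\<in>UNIV. \<Sum>j\<in>UNIV. \<gamma> $ i $ j)"
      using g by (intro sum.cong) (auto simp: S_iff)
    also have "\<dots> = 1" using g mu1 by (simp add: S_iff prob_vec_def)
    finally show "norm \<gamma> \<le> 1" .
  qed
  have cl: "closed S"
  proof -
    have "S = (\<Inter>i. {\<gamma>. (\<Sum>j\<in>UNIV. \<gamma> $ i $ j) = \<mu>\<^sub>1 $ i}) \<inter>
        (\<Inter>j. {\<gamma>. (\<Sum>i\<in>UNIV. \<gamma> $ i $ j) = \<mu>\<^sub>2 $ j}) \<inter> (\<Inter>i j. {\<gamma>. 0 \<le> \<gamma> $ i $ j})"
      by (auto simp: S_iff)
    then show ?thesis
      by (auto intro!: closed_Int closed_INT closed_Collect_eq closed_Collect_le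
          continuous_intros)
  qed
  have ct: "continuous_on S (entropic_cost c \<epsilon>)"
    unfolding entropic_cost_altdef
    by (intro continuous_intros continuous_on_compose2[OF continuous_on_xlnx])
      (auto simp: S_iff)
  obtain \<gamma>\<^sub>0 where opt: "is_optimal_plan c \<epsilon> \<mu>\<^sub>1 \<mu>\<^sub>2 \<gamma>\<^sub>0"
    using continuous_attains_inf[OF _ _ ct] bd cl ne
    by (auto simp: compact_eq_bounded_closed opt_iff)
  have "\<gamma> = \<eta>" if "is_optimal_plan c \<epsilon> \<mu>\<^sub>1 \<mu>\<^sub>2 \<gamma>" "is_optimal_plan c \<epsilon> \<mu>\<^sub>1 \<mu>\<^sub>2 \<eta>" for \<gamma> \<eta>
  proof (rule ccontr)
    assume "\<gamma> \<noteq> \<eta>"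
    then obtain a b where ab: "\<gamma> $ a $ b \<noteq> \<eta> $ a $ b" by (auto simp: vec_eq_iff)
    define m :: "real^'m^'n" where "m = (\<chi> i j. (\<gamma> $ i $ j + \<eta> $ i $ j) / 2)"
    have g: "\<gamma> \<in> S" "\<eta> \<in> S" and "entropic_cost c \<epsilon> \<gamma> = entropic_cost c \<epsilon> \<eta>"
      using that by (auto simp: opt_iff intro: antisym)
    have nn: "0 \<le> \<gamma> $ i $ j" "0 \<le> \<eta> $ i $ j" for i j using g by (auto simp: S_iff)
    have mS: "m \<in> S"
      using g unfolding S_iff m_def
      by (auto simp: sum_divide_distrib[symmetric] sum.distrib)
    define h where "h = (\<lambda>(\<xi>::real^'m^'n) i j.
       (c $ i $ j - \<epsilon>) * \<xi> $ i $ j + \<epsilon> * (\<xi> $ i $ j * ln (\<xi> $ i $ j) + 1))"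
    have h: "entropic_cost c \<epsilon> \<xi> = (\<Sum>i\<in>UNIV. \<Sum>j\<in>UNIV. h \<xi> i j)" for \<xi>
      by (simp add: entropic_cost_altdef h_def)
    have hdiff: "h \<gamma> i j + h \<eta> i j - 2 * h m i j = \<epsilon> *
       (\<gamma> $ i $ j * ln (\<gamma> $ i $ j) + \<eta> $ i $ j * ln (\<eta> $ i $ j) -
        2 * ((\<gamma> $ i $ j + \<eta> $ i $ j) / 2 * ln ((\<gamma> $ i $ j + \<eta> $ i $ j) / 2)))" for i j
      unfolding h_def m_def vec_lambda_beta by algebra
    have le: "0 \<le> h \<gamma> i j + h \<eta> i j - 2 * h m i j" for i j
      unfolding hdiff using xlnx_midpoint(1)[OF nn[of i j]] eps by simp
    have lt: "0 < h \<gamma> a b + h \<eta> a b - 2 * h m a b"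
      unfolding hdiff using xlnx_midpoint(2)[OF nn[of a b] ab] eps by simp
    have "0 < (\<Sum>i\<in>UNIV. \<Sum>j\<in>UNIV. h \<gamma> i j + h \<eta> i j - 2 * h m i j)"
      using le lt by (intro sum_pos2[of _ a] sum_pos2[of _ b] sum_nonneg) auto
    also have "\<dots> = entropic_cost c \<epsilon> \<gamma> + entropic_cost c \<epsilon> \<eta> - 2 * entropic_cost c \<epsilon> m"
      by (simp add: h sum.distrib sum_subtractf sum_distrib_left)
    finally show False
      using that mS unfolding opt_iff by force
  qed
  then show ?thesis using opt by blast
qed

end

theory Submission
  imports Defs
begin

text \<open>
  Write \<open>w\<close> for the ratios of marginals \<open>(A\<^sub>k \<gamma>) \<oslash> \<mu>\<^sub>k\<close>. Since \<open>\<gamma>\<^sup>*\<close> satisfies the constraint, the decrease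
  of \<open>F\<close> under the \<open>\<omega>\<close>-relaxed projection is exactly \<open>\<Sum>\<^sub>i (\<mu>\<^sub>k)\<^sub>i \<phi>\<^sub>\<omega>(w\<^sub>i)\<close>, whatever the
  other properties of \<open>\<gamma>\<^sup>*\<close>. Two facts about \<open>\<phi>\<close> make every summand nonnegative for
  \<open>\<omega> = \<Theta>(w)\<close>: if \<open>\<phi>\<^sub>\<omega>\<close> is nonnegative at a point, it is nonnegative to the right of it
  (\<open>t \<mapsto> \<phi>\<^sub>\<omega>(e\<^sup>t)\<close> vanishes at \<open>0\<close> and has a convex derivative that vanishes at \<open>0\<close>); and
  \<open>\<omega> \<mapsto> \<phi>\<^sub>\<omega>(x)\<close> is concave with \<open>\<phi>\<^sub>1(x) > 0\<close> for \<open>x \<noteq> 1\<close>, so \<open>\<phi>\<^sub>\<omega>(x) > 0\<close> for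
  \<open>1 \<le> \<omega> < \<theta>\<close> whenever \<open>\<phi>\<^sub>\<theta>(x) \<ge> 0\<close>. The same strict positivity gives the continuity of
  \<open>\<Theta>\<^sup>*\<close>, except where \<open>min w = 1\<close>: there \<open>\<Theta>\<^sup>* = 2\<close>, and for each \<open>\<omega> < 2\<close> the function
  \<open>\<phi>\<^sub>\<omega>\<close> has a local minimum of value \<open>0\<close> at \<open>1\<close>.
\<close>

section \<open>Sign of \<open>\<phi>\<close>, studied through the substitution x = exp t\<close>

lemma phi_exp: "\<phi> \<omega> (exp t) = exp t - exp ((1 - \<omega>) * t) - \<omega> * t"
proof -
  have "exp t * exp (- \<omega> * t) = exp ((1 - \<omega>) * t)"
    unfolding exp_add[symmetric] by (simp add: algebra_simps)
  then show ?thesis by (simp add: \<phi>_def powr_def right_diff_distrib)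
qed

lemma phi_one_pos:
  assumes "0 < x" "x \<noteq> 1" shows "0 < \<phi> 1 x"
proof -
  have "ln x < x - 1"
    using assms ln_le_minus_one[of x] ln_eq_minus_one[of x] by fastforce
  then show ?thesis
    using assms by (simp add: \<phi>_def powr_minus right_diff_distrib)
qed

lemma phi_at_1 [simp]: "\<phi> \<omega> 1 = 0"
  by (simp add: \<phi>_def)

lemma DERIV_phi_exp:
  "((\<lambda>t. \<phi> \<omega> (exp t)) has_real_derivative exp t + (\<omega> - 1) * exp ((1 - \<omega>) * t) - \<omega>) (at t)"
  unfolding phi_exp by (rule derivative_eq_intros refl | simp)+ (simp add: algebra_simps)

text \<open>Convexity is available only one derivative up: \<open>\<phi> \<omega> (exp t)\<close>
  itself fails to be convex for very negative t when \<omega> > 1.\<close>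

lemma deriv_phi_exp_convex:
  assumes "1 \<le> \<omega>"
  shows "convex_on UNIV (\<lambda>t. exp t + (\<omega> - 1) * exp ((1 - \<omega>) * t) - \<omega> :: real)"
proof (rule f''_ge0_imp_convex)
  show "((\<lambda>t. exp t + (\<omega> - 1) * exp ((1 - \<omega>) * t) - \<omega>) has_real_derivative
      exp t - (\<omega> - 1)\<^sup>2 * exp ((1 - \<omega>) * t)) (at t)" for t
    by (auto intro!: derivative_eq_intros simp: algebra_simps power2_eq_square)
  show "((\<lambda>t. exp t - (\<omega> - 1)\<^sup>2 * exp ((1 - \<omega>) * t)) has_real_derivative
      exp t + (\<omega> - 1) ^ 3 * exp ((1 - \<omega>) * t)) (at t)" for t
    by (auto intro!: derivative_eq_intros simp: algebra_simps power2_eq_square power3_eq_cube)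
qed (use assms in auto)

lemma phi_two_nonneg:
  assumes "1 \<le> x" shows "0 \<le> \<phi> 2 x"
proof -
  have "\<phi> 2 (exp 0) \<le> \<phi> 2 (exp (ln x))"
  proof (rule DERIV_nonneg_imp_nondecreasing[where f = "\<lambda>t. \<phi> 2 (exp t)"])
    fix t :: real
    \<comment> \<open>At \<omega> = 2 the derivative in t is a perfect square, so the function
      increases from its zero at t = 0.\<close>
    have "exp t + exp (- t) - 2 = (exp (t / 2) - exp (- (t / 2)))\<^sup>2"
      by (simp add: power2_eq_square algebra_simps flip: exp_add)
    then have "0 \<le> exp t + (2 - 1) * exp ((1 - 2) * t) - 2" by simp
    then show "\<exists>y. ((\<lambda>t. \<phi> 2 (exp t)) has_real_derivative y) (at t) \<and> 0 \<le> y"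
      using DERIV_phi_exp by blast
  qed (use assms in simp)
  then show ?thesis using assms by simp
qed

lemma phi_pos:
  assumes "0 < x" "x \<noteq> 1" "1 \<le> \<omega>" "\<omega> < \<theta>" "0 \<le> \<phi> \<theta> x"
  shows "0 < \<phi> \<omega> x"
proof -
  define f where "f = (\<lambda>\<omega>. - \<phi> \<omega> x)"
  have "convex_on UNIV f"
  proof (rule f''_ge0_imp_convex)
    show "(f has_real_derivative ln x - x * x powr (- \<omega>) * ln x) (at \<omega>)" for \<omega>
      using assms unfolding f_def \<phi>_def
      by (auto intro!: derivative_eq_intros simp: algebra_simps)
    show "((\<lambda>\<omega>. ln x - x * x powr (- \<omega>) * ln x) has_real_derivative
        x * x powr (- \<omega>) * (ln x)\<^sup>2) (at \<omega>)" for \<omega>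
      using assms by (auto intro!: derivative_eq_intros simp: power2_eq_square)
  qed (use assms in auto)
  \<comment> \<open>Weight writing \<omega> as a convex combination of 1 and \<theta>. Since l < 1,
    the endpoint 1, where \<open>f\<close> is strictly negative, keeps positive weight.\<close>
  define l where "l = (\<omega> - 1) / (\<theta> - 1)"
  have l: "0 \<le> l" "l < 1" using assms by (auto simp: l_def)
  have "l * (\<theta> - 1) = \<omega> - 1"
    using assms by (simp add: l_def)
  then have "\<omega> = (1 - l) * 1 + l * \<theta>"
    by (simp add: algebra_simps)
  then have "f \<omega> \<le> (1 - l) * f 1 + l * f \<theta>"
    using convex_onD[OF \<open>convex_on UNIV f\<close>, of l 1 \<theta>] l by simp
  moreover have "(1 - l) * f 1 < 0"
    using phi_one_pos[of x] assms l by (simp add: f_def mult_less_0_iff)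
  moreover have "l * f \<theta> \<le> 0"
    using assms l by (simp add: f_def)
  ultimately show ?thesis by (simp add: f_def)
qed

text \<open>For x \<ge> 1, nonnegativity at \<omega> = 2 passes down to smaller \<omega>. For x < 1,
  a negative value at x would force, by the mean value theorem, a negative slope left of ln x and a
  positive slope between ln x and 0. The convex derivative, zero at 0, excludes this order of
  signs.\<close>

lemma phi_nonneg_mono:
  assumes "1 \<le> \<omega>" "\<omega> \<le> 2" "0 < m" "m \<le> x" "0 \<le> \<phi> \<omega> m"
  shows "0 \<le> \<phi> \<omega> x"
proof (cases "1 \<le> x")
  case True
  then show ?thesis
    using phi_two_nonneg[of x] phi_pos[of x \<omega> 2] assms by (cases "x = 1"; cases "\<omega> = 2") auto
next
  case False
  show ?thesis
  proof (rule ccontr)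
    assume neg: "\<not> 0 \<le> \<phi> \<omega> x"
    define f where "f = (\<lambda>t. \<phi> \<omega> (exp t))"
    define g where "g = (\<lambda>t. exp t + (\<omega> - 1) * exp ((1 - \<omega>) * t) - \<omega>)"
    have D: "(f has_real_derivative g t) (at t)" for t
      unfolding f_def g_def by (rule DERIV_phi_exp)
    have x: "0 < x" "m < x" using assms neg by (cases "m = x"; auto)+
    obtain u where u: "ln m < u" "u < ln x" "f (ln x) - f (ln m) = (ln x - ln m) * g u"
      using MVT2[of "ln m" "ln x" f g] x assms D by auto
    obtain v where v: "ln x < v" "v < 0" "f 0 - f (ln x) = (0 - ln x) * g v"
      using MVT2[of "ln x" 0 f g] x False D by auto
    have "(ln x - ln m) * g u < 0"
      using u(3) neg assms x by (simp add: f_def)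
    moreover have "0 < ln x - ln m" using x assms by simp
    ultimately have gu: "g u < 0" by (simp add: mult_less_0_iff)
    have "(0 - ln x) * g v > 0" unfolding v(3)[symmetric] using neg x by (simp add: f_def)
    then have gv: "g v > 0" using v(1,2) by (simp add: zero_less_mult_iff mult_less_0_iff)
    \<comment> \<open>The weight that places v between u and 0.\<close>
    define l where "l = (u - v) / u"
    have u0: "u < 0" using u v by simp
    have l: "0 \<le> l" "l < 1" "v = (1 - l) * u + l * 0"
      using u v u0 by (auto simp: l_def field_simps)
    have "g v \<le> (1 - l) * g u + l * g 0"
      using convex_onD[OF deriv_phi_exp_convex[OF assms(1), folded g_def], of l u 0] l by simp
    moreover have "g 0 = 0" by (simp add: g_def)
    moreover have "(1 - l) * g u < 0" using gu l by (simp add: mult_less_0_iff)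
    ultimately show False using gv by simp
  qed
qed

lemma phi_nonneg_left_of_1:
  assumes "1 \<le> \<omega>" "\<omega> < 2"
  obtains m where "0 < m" "m < 1" "0 \<le> \<phi> \<omega> m"
proof -
  define a where "a = \<omega> - 1"
  have a: "0 \<le> a" "a < 1" and w: "\<omega> = 1 + a" using assms by (auto simp: a_def)
  \<comment> \<open>The expression below is (1 - a^2) s^2 / 2 to leading order as s tends to 0,
    because the linear terms cancel. Hence the need for \<omega> < 2.\<close>
  have "a * a < 1" using a mult_strict_mono[of a 1 a 1] by simp
  then have "\<forall>\<^sub>F s in at_right 0. 0 < exp (- s) - exp (a * s) + (1 + a) * s"
    using a by real_asymp
  then obtain s :: real where s: "0 < s" "0 < exp (- s) - exp (a * s) + (1 + a) * s"
    by (metis (mono_tags, lifting) eventually_at_right_field dense)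
  have "0 \<le> \<phi> \<omega> (exp (- s))"
    using s by (simp add: phi_exp w algebra_simps)
  then show thesis using s by (intro that[of "exp (- s)"]) auto
qed

section \<open>The threshold \<open>Theta_star\<close> and its continuity\<close>

lemma
  fixes w :: "real^'n"
  assumes "0 < min_coord w"
  shows Theta_star_mem: "Theta_star w \<in> {1..2}"
    and Theta_star_upper: "\<omega> \<in> {1..2} \<Longrightarrow> 0 \<le> \<phi> \<omega> (min_coord w) \<Longrightarrow> \<omega> \<le> Theta_star w"
    and less_Theta_starD: "1 \<le> \<omega> \<Longrightarrow> \<omega> < Theta_star w \<Longrightarrow> \<exists>\<theta>\<in>{1..2}. \<omega> < \<theta> \<and> 0 \<le> \<phi> \<theta> (min_coord w)"
proof -
  let ?S = "{\<omega> \<in> {1..2}. 0 \<le> \<phi> \<omega> (min_coord w)}"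
  \<comment> \<open>The supremum is over a nonempty set, so it is meaningful and at least 1.\<close>
  have 1: "1 \<in> ?S"
    using phi_one_pos[of "min_coord w"] assms by (cases "min_coord w = 1") auto
  have bdd: "bdd_above ?S" by (rule bdd_aboveI[of _ 2]) auto
  show upper: "\<omega> \<le> Theta_star w" if "\<omega> \<in> {1..2}" "0 \<le> \<phi> \<omega> (min_coord w)" for \<omega>
    unfolding Theta_star_def using that bdd by (intro cSup_upper) auto
  have "Theta_star w \<le> 2"
    unfolding Theta_star_def using 1 by (intro cSup_least) (blast, simp)
  then show "Theta_star w \<in> {1..2}"
    using 1 upper by auto
  show "\<exists>\<theta>\<in>{1..2}. \<omega> < \<theta> \<and> 0 \<le> \<phi> \<theta> (min_coord w)" if "1 \<le> \<omega>" "\<omega> < Theta_star w"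
    using that less_cSup_iff[OF _ bdd] 1 unfolding Theta_star_def by blast
qed

lemma min_coord_pos:
  fixes w :: "real^'n"
  shows "0 < min_coord w \<longleftrightarrow> (\<forall>i. 0 < w $ i)"
  by (auto simp: min_coord_def)

lemma min_coord_le: "min_coord w \<le> w $ i"
  by (simp add: min_coord_def)

lemma isCont_min_coord: "isCont min_coord (w :: real^'n)"
proof -
  \<comment> \<open>Generalised from the whole index type to finite nonempty sets, to allow
    induction.\<close>
  have "isCont (\<lambda>w. Min ((($) w) ` A)) w" if "finite A" "A \<noteq> {}" for A :: "'n set"
    using that
  proof (induction rule: finite_ne_induct)
    case (insert i A)
    have "isCont (\<lambda>w. min (w $ i) (Min ((($) w) ` A))) w"
      using insert.IH unfolding isCont_def by (intro tendsto_min tendsto_intros) auto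
    then show ?case using insert.hyps by simp
  qed auto
  then show ?thesis unfolding min_coord_def by simp
qed

lemma isCont_phi: "0 < x \<Longrightarrow> isCont (\<phi> \<omega>) x"
  unfolding \<phi>_def by (auto intro!: continuous_intros)

lemma isCont_Theta_star:
  fixes w :: "real^'n"
  assumes w: "\<And>i. 0 < w $ i"
  shows "isCont Theta_star w"
  unfolding isCont_def
proof (rule order_tendstoI)
  have w0: "0 < min_coord w" using w by (simp add: min_coord_pos)
  have ev_pos: "\<forall>\<^sub>F v in at w. 0 < min_coord v"
    using isCont_min_coord[of w] w0 unfolding isCont_def by (rule order_tendstoD)
  have phi_lim: "((\<lambda>v. \<phi> \<omega> (min_coord v)) \<longlongrightarrow> \<phi> \<omega> (min_coord w)) (at w)" for \<omega>
    using isCont_phi[OF w0] isCont_min_coord[of w] isCont_o2 unfolding isCont_def by blast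
  fix a
  show "\<forall>\<^sub>F v in at w. Theta_star v < a" if a: "Theta_star w < a"
  proof (cases "a \<le> 2")
    case True
    \<comment> \<open>A strict gap above \<open>Theta_star w\<close> gives a strict sign, which
      persists nearby. Any admissible \<theta> > b at v would contradict it through
      \<open>phi_pos\<close>.\<close>
    define b where "b = (Theta_star w + a) / 2"
    have b: "Theta_star w < b" "b < a" "b \<in> {1..2}"
      using a True Theta_star_mem[OF w0] by (auto simp: b_def)
    then have "\<phi> b (min_coord w) < 0"
      using Theta_star_upper[OF w0] by force
    from order_tendstoD(2)[OF phi_lim this] ev_pos show ?thesis
    proof eventually_elim
      case (elim v)
      show ?case
      proof (rule ccontr)
        assume "\<not> Theta_star v < a"
        then obtain \<theta> where "b < \<theta>" "0 \<le> \<phi> \<theta> (min_coord v)"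
          using less_Theta_starD[OF elim(2), of b] b by auto
        then show False
          using phi_pos[OF elim(2), of b \<theta>] elim(1) b by (cases "min_coord v = 1") auto
      qed
    qed
  next
    case False
    from ev_pos show ?thesis
      by eventually_elim (use Theta_star_mem False in fastforce)
  qed
  show "\<forall>\<^sub>F v in at w. a < Theta_star v" if a: "a < Theta_star w"
  proof (cases "1 \<le> a")
    case True
    then obtain \<theta> where t: "\<theta> \<in> {1..2}" "a < \<theta>" "0 \<le> \<phi> \<theta> (min_coord w)"
      using less_Theta_starD[OF w0] a by blast
    \<comment> \<open>Strictly below the admissible \<theta>, so that \<open>phi_pos\<close>
      applies, and below 2, as needed when the minimum is 1.\<close>
    define b where "b = (a + \<theta>) / 2"
    have b: "a < b" "b < \<theta>" "1 \<le> b" "b < 2" using t True by (auto simp: b_def)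
    have "\<forall>\<^sub>F v in at w. 0 \<le> \<phi> b (min_coord v)"
    proof (cases "min_coord w = 1")
      case True
      \<comment> \<open>The limit value is 0 here, so continuity alone decides no sign. A point left
        of 1 with nonnegative value controls a whole neighbourhood of 1 by
        \<open>phi_nonneg_mono\<close>.\<close>
      obtain m where m: "0 < m" "m < 1" "0 \<le> \<phi> b m"
        using phi_nonneg_left_of_1 b by blast
      then have "\<forall>\<^sub>F v in at w. m < min_coord v"
        using isCont_min_coord[of w] True unfolding isCont_def by (auto intro: order_tendstoD)
      then show ?thesis
        by eventually_elim (use phi_nonneg_mono[of b m] m b in auto)
    next
      case False
      then have "0 < \<phi> b (min_coord w)"
        using phi_pos[OF w0] b t by blast
      from order_tendstoD(1)[OF phi_lim this] show ?thesis
        by eventually_elim simp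
    qed
    with ev_pos show ?thesis
      by eventually_elim (use b Theta_star_upper[of _ b] in fastforce)
  next
    case False
    from ev_pos show ?thesis
      by eventually_elim (use Theta_star_mem False in fastforce)
  qed
qed

text \<open>Unless \<open>Theta\<close> equals 1, the margin \<delta> keeps it strictly below
  \<open>Theta_star\<close>. An admissible \<theta> above it transfers from the smallest coordinate
  to every other, and the gap to \<theta> makes the sign strict.\<close>

lemma phi_Theta_pos:
  fixes w :: "real^'n"
  assumes w: "\<And>i. 0 < w $ i" and "1 \<le> \<theta>\<^sub>0" "0 < \<delta>" and ne: "w $ i \<noteq> 1"
  shows "0 < \<phi> (Theta \<theta>\<^sub>0 \<delta> w) (w $ i)"
proof (cases "Theta \<theta>\<^sub>0 \<delta> w = 1")
  case True
  then show ?thesis using phi_one_pos w ne by simp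
next
  case False
  then have T: "1 < Theta \<theta>\<^sub>0 \<delta> w" "Theta \<theta>\<^sub>0 \<delta> w < Theta_star w"
    using assms by (auto simp: Theta_def min_def max_def split: if_splits)
  have w0: "0 < min_coord w" using w by (simp add: min_coord_pos)
  obtain \<theta> where t: "\<theta> \<in> {1..2}" "Theta \<theta>\<^sub>0 \<delta> w < \<theta>" "0 \<le> \<phi> \<theta> (min_coord w)"
    using less_Theta_starD[OF w0, of "Theta \<theta>\<^sub>0 \<delta> w"] T by auto
  have "0 \<le> \<phi> \<theta> (w $ i)"
    using phi_nonneg_mono[OF _ _ w0 min_coord_le t(3)] t(1) by simp
  then show ?thesis using phi_pos[OF w ne] T t by auto
qed

section \<open>Descent and continuity for the row constraint\<close>

lemma row_sums_pos:
  "\<gamma> \<in> pos_mats \<Longrightarrow> 0 < row_sums \<gamma> $ i"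
  by (auto simp: row_sums_def pos_mats_def intro!: sum_pos)

text \<open>Relaxation in the logarithm turns the row scaling into its power.\<close>

lemma relaxed_row_proj:
  fixes \<gamma> :: "real^'m^'n"
  assumes "\<gamma> \<in> pos_mats" "0 < \<mu> $ i"
  shows "relaxed (row_proj \<mu>) \<omega> \<gamma> $ i $ j = \<gamma> $ i $ j * (row_sums \<gamma> $ i / \<mu> $ i) powr (- \<omega>)"
proof -
  have g: "0 < \<gamma> $ i $ j" for i j using assms by (simp add: pos_mats_def)
  have r: "0 < row_sums \<gamma> $ i" using assms(1) by (rule row_sums_pos)
  have "(1 - \<omega>) * ln (\<gamma> $ i $ j) + \<omega> * ln (\<mu> $ i / row_sums \<gamma> $ i * \<gamma> $ i $ j)
      = ln (\<gamma> $ i $ j) + - \<omega> * ln (row_sums \<gamma> $ i / \<mu> $ i)"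
    using assms g[of i j] r by (simp add: ln_mult ln_div algebra_simps)
  then show ?thesis
    using assms g[of i j] r unfolding relaxed_def row_proj_def vec_lambda_beta
    by (simp only: exp_add) (simp add: powr_def)
qed

text \<open>The scaling factor is constant along a row, so the logarithmic terms see \<eta> only
  through its row mass. The change in the mass of \<gamma> supplies the remaining part of
  \<open>\<phi>\<close>.\<close>

lemma KL_relaxed_row_proj:
  fixes \<gamma> \<eta> :: "real^'m^'n"
  assumes \<eta>: "\<eta> \<in> nonneg_mats" "row_sums \<eta> = \<mu>"
    and \<gamma>: "\<gamma> \<in> pos_mats" and \<mu>: "\<And>i. 0 < \<mu> $ i"
  shows "KL \<eta> \<gamma> - KL \<eta> (relaxed (row_proj \<mu>) \<omega> \<gamma>)
    = (\<Sum>i\<in>UNIV. \<mu> $ i * \<phi> \<omega> ((row_sums \<gamma> \<oslash> \<mu>) $ i))"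
proof -
  define w where "w = row_sums \<gamma> \<oslash> \<mu>"
  have g: "0 < \<gamma> $ i $ j" for i j using \<gamma> by (simp add: pos_mats_def)
  have w: "0 < w $ i" for i
    using \<mu> row_sums_pos[OF \<gamma>] by (simp add: w_def vec_divide_def)
  have rel: "relaxed (row_proj \<mu>) \<omega> \<gamma> $ i $ j = \<gamma> $ i $ j * w $ i powr (- \<omega>)" for i j
    using relaxed_row_proj[OF \<gamma> \<mu>] by (simp add: w_def vec_divide_def)
  have entry: "\<eta> $ i $ j * (ln (\<eta> $ i $ j / \<gamma> $ i $ j) - 1)
      - \<eta> $ i $ j * (ln (\<eta> $ i $ j / (\<gamma> $ i $ j * w $ i powr (- \<omega>))) - 1)
      = \<eta> $ i $ j * (- \<omega> * ln (w $ i))" for i j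
  \<comment> \<open>Logarithms of quotients split only for positive entries; at a zero entry both
    sides vanish.\<close>
  proof (cases "\<eta> $ i $ j = 0")
    case False
    then have "0 < \<eta> $ i $ j" using \<eta> by (simp add: nonneg_mats_def order_less_le)
    then show ?thesis
      using g[of i j] w[of i] by (simp add: ln_div ln_mult ln_powr algebra_simps)
  qed simp
  have row: "(\<Sum>j\<in>UNIV. \<eta> $ i $ j * (- \<omega> * ln (w $ i)))
      + (\<Sum>j\<in>UNIV. \<gamma> $ i $ j - \<gamma> $ i $ j * w $ i powr (- \<omega>)) = \<mu> $ i * \<phi> \<omega> (w $ i)" for i
  proof -
    have 1: "(\<Sum>j\<in>UNIV. \<eta> $ i $ j) = \<mu> $ i" using \<eta> by (auto simp: row_sums_def)
    have 2: "(\<Sum>j\<in>UNIV. \<gamma> $ i $ j) = \<mu> $ i * w $ i"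
      using \<mu>[of i] by (simp add: w_def vec_divide_def row_sums_def)
    show ?thesis
      unfolding sum_subtractf sum_distrib_right[symmetric] 1 2 \<phi>_def
      by (simp add: algebra_simps)
  qed
  have "KL \<eta> \<gamma> - KL \<eta> (relaxed (row_proj \<mu>) \<omega> \<gamma>) =
      (\<Sum>i\<in>UNIV. (\<Sum>j\<in>UNIV. \<eta> $ i $ j * (ln (\<eta> $ i $ j / \<gamma> $ i $ j) - 1)
      - \<eta> $ i $ j * (ln (\<eta> $ i $ j / (\<gamma> $ i $ j * w $ i powr (- \<omega>))) - 1))
      + (\<Sum>j\<in>UNIV. \<gamma> $ i $ j - \<gamma> $ i $ j * w $ i powr (- \<omega>)))"
    unfolding KL_def rel sum_subtractf sum.distrib by simp
  also have "\<dots> = (\<Sum>i\<in>UNIV. \<mu> $ i * \<phi> \<omega> (w $ i))"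
    unfolding entry row ..
  finally show ?thesis unfolding w_def .
qed

text \<open>Stated for any nonnegative \<eta> in the constraint set, so that the column case can
  apply it to transposes without an optimality claim for them.\<close>

lemma row_descent:
  fixes \<gamma> \<eta> :: "real^'m^'n"
  assumes \<eta>: "\<eta> \<in> nonneg_mats" "\<eta> \<in> row_constraint \<mu>"
    and \<gamma>: "\<gamma> \<in> pos_mats" and \<mu>: "prob_vec \<mu>" and "1 \<le> \<theta>\<^sub>0" "0 < \<delta>"
  defines "\<gamma>' \<equiv> relaxed (row_proj \<mu>) (row_Theta \<theta>\<^sub>0 \<delta> \<mu> \<gamma>) \<gamma>"
  shows "KL \<eta> \<gamma>' \<le> KL \<eta> \<gamma> \<and> (\<gamma> \<notin> row_constraint \<mu> \<longrightarrow> KL \<eta> \<gamma>' < KL \<eta> \<gamma>)"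
proof -
  define w where "w = row_sums \<gamma> \<oslash> \<mu>"
  have \<mu>0: "0 < \<mu> $ i" for i using \<mu> by (simp add: prob_vec_def)
  have w: "0 < w $ i" for i
    using \<mu>0 row_sums_pos[OF \<gamma>] by (simp add: w_def vec_divide_def)
  have diff: "KL \<eta> \<gamma> - KL \<eta> \<gamma>' = (\<Sum>i\<in>UNIV. \<mu> $ i * \<phi> (Theta \<theta>\<^sub>0 \<delta> w) (w $ i))"
    unfolding \<gamma>'_def row_Theta_def w_def
    using \<eta> \<gamma> \<mu>0 by (intro KL_relaxed_row_proj) (auto simp: row_constraint_def)
  have pos: "0 < \<mu> $ i * \<phi> (Theta \<theta>\<^sub>0 \<delta> w) (w $ i)" if "w $ i \<noteq> 1" for i
    using phi_Theta_pos[of w] w \<mu>0 assms(5,6) that by simp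
  have nonneg: "0 \<le> \<mu> $ i * \<phi> (Theta \<theta>\<^sub>0 \<delta> w) (w $ i)" for i
    using pos[of i] by (cases "w $ i = 1") auto
  have "KL \<eta> \<gamma>' < KL \<eta> \<gamma>" if "\<gamma> \<notin> row_constraint \<mu>"
  proof -
    \<comment> \<open>A violated constraint makes one ratio differ from 1, hence one summand
      strictly positive.\<close>
    from that obtain i where "row_sums \<gamma> $ i \<noteq> \<mu> $ i"
      by (auto simp: row_constraint_def vec_eq_iff)
    then have "w $ i \<noteq> 1" using \<mu>0[of i] by (simp add: w_def vec_divide_def)
    then have "0 < KL \<eta> \<gamma> - KL \<eta> \<gamma>'"
      unfolding diff using pos nonneg by (intro sum_pos2[of _ i]) auto
    then show ?thesis by simp
  qed
  moreover have "0 \<le> KL \<eta> \<gamma> - KL \<eta> \<gamma>'"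
    unfolding diff using nonneg by (intro sum_nonneg) auto
  ultimately show ?thesis by simp
qed

lemma continuous_on_row_Theta:
  assumes \<mu>: "prob_vec \<mu>"
  shows "continuous_on pos_mats (row_Theta \<theta>\<^sub>0 \<delta> \<mu> :: real^'m^'n \<Rightarrow> real)"
proof -
  have "continuous_on {w. \<forall>i. 0 < w $ i} (Theta \<theta>\<^sub>0 \<delta> :: real^'n \<Rightarrow> real)"
    unfolding Theta_def
    by (intro continuous_intros continuous_at_imp_continuous_on ballI isCont_Theta_star) auto
  moreover have "continuous_on pos_mats (\<lambda>\<gamma> :: real^'m^'n. row_sums \<gamma> \<oslash> \<mu>)"
    using \<mu> unfolding row_sums_def vec_divide_def prob_vec_def
    by (intro continuous_intros) (auto simp: less_imp_neq[symmetric])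
  moreover have "(\<lambda>\<gamma> :: real^'m^'n. row_sums \<gamma> \<oslash> \<mu>) ` pos_mats \<subseteq> {w. \<forall>i. 0 < w $ i}"
    using \<mu> row_sums_pos by (fastforce simp: vec_divide_def prob_vec_def)
  ultimately show ?thesis
    unfolding row_Theta_def by (rule continuous_on_compose2)
qed

section \<open>Columns reduced to rows by transposition\<close>

lemma KL_transpose:
  fixes \<gamma> \<zeta> :: "real^'b^'a"
  shows "KL (transpose \<gamma>) (transpose \<zeta>) = KL \<gamma> \<zeta>"
proof -
  \<comment> \<open>The fixed index types orient the exchange, so that unfolding with it
    terminates.\<close>
  have swap: "(\<Sum>j\<in>UNIV. \<Sum>i\<in>UNIV. f i j) = (\<Sum>i\<in>UNIV. \<Sum>j\<in>UNIV. f i j)"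
    for f :: "'a \<Rightarrow> 'b \<Rightarrow> real"
    by (rule sum.swap)
  show ?thesis
    unfolding KL_def transpose_def vec_lambda_beta swap ..
qed

lemma row_sums_transpose: "row_sums (transpose \<gamma>) = col_sums \<gamma>"
  by (simp add: row_sums_def col_sums_def transpose_def)

lemma col_Theta_transpose: "col_Theta \<theta>\<^sub>0 \<delta> \<mu> \<gamma> = row_Theta \<theta>\<^sub>0 \<delta> \<mu> (transpose \<gamma>)"
  by (simp add: col_Theta_def row_Theta_def row_sums_transpose)

lemma relaxed_col_proj_transpose:
  "transpose (relaxed (col_proj \<mu>) \<omega> \<gamma>) = relaxed (row_proj \<mu>) \<omega> (transpose \<gamma>)"
  by (simp add: relaxed_def row_proj_def col_proj_def row_sums_transpose mult.commute)
    (simp add: transpose_def)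

lemma transpose_mem:
  "transpose \<gamma> \<in> nonneg_mats \<longleftrightarrow> \<gamma> \<in> nonneg_mats"
  "transpose \<gamma> \<in> pos_mats \<longleftrightarrow> \<gamma> \<in> pos_mats"
  "transpose \<gamma> \<in> row_constraint \<mu> \<longleftrightarrow> \<gamma> \<in> col_constraint \<mu>"
  by (auto simp: nonneg_mats_def pos_mats_def row_constraint_def col_constraint_def
      row_sums_transpose) (auto simp: transpose_def)

lemma col_descent:
  fixes \<gamma> \<eta> :: "real^'m^'n"
  assumes "\<eta> \<in> nonneg_mats" "\<eta> \<in> col_constraint \<mu>"
    and "\<gamma> \<in> pos_mats" and "prob_vec \<mu>" and "1 \<le> \<theta>\<^sub>0" "0 < \<delta>"
  defines "\<gamma>' \<equiv> relaxed (col_proj \<mu>) (col_Theta \<theta>\<^sub>0 \<delta> \<mu> \<gamma>) \<gamma>"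
  shows "KL \<eta> \<gamma>' \<le> KL \<eta> \<gamma> \<and> (\<gamma> \<notin> col_constraint \<mu> \<longrightarrow> KL \<eta> \<gamma>' < KL \<eta> \<gamma>)"
  using row_descent[of "transpose \<eta>" \<mu> "transpose \<gamma>" \<theta>\<^sub>0 \<delta>] assms
  by (simp add: transpose_mem col_Theta_transpose[symmetric] KL_transpose
      relaxed_col_proj_transpose[symmetric])

lemma continuous_on_col_Theta:
  assumes "prob_vec \<mu>"
  shows "continuous_on pos_mats (col_Theta \<theta>\<^sub>0 \<delta> \<mu> :: real^'m^'n \<Rightarrow> real)"
proof -
  have "continuous_on pos_mats (transpose :: real^'m^'n \<Rightarrow> _)"
    unfolding transpose_def by (intro continuous_intros)
  then show ?thesis
    unfolding col_Theta_transpose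
    by (rule continuous_on_compose2[OF continuous_on_row_Theta[OF assms]])
      (auto simp: transpose_mem)
qed

theorem proposition1:
  fixes \<mu>\<^sub>1 :: "real^'n" and \<mu>\<^sub>2 :: "real^'m" and c :: "real^'m^'n"
    and \<epsilon> \<theta>\<^sub>0 \<delta> :: real
  assumes "prob_vec \<mu>\<^sub>1" and "prob_vec \<mu>\<^sub>2"
    and "c \<in> nonneg_mats" and "0 < \<epsilon>"
    and "1 \<le> \<theta>\<^sub>0" and "\<theta>\<^sub>0 < 2" and "0 < \<delta>"
  shows
    "(continuous_on pos_mats (row_Theta \<theta>\<^sub>0 \<delta> \<mu>\<^sub>1 :: real^'m^'n \<Rightarrow> real) \<and>
      (\<forall>\<gamma> \<in> (pos_mats :: (real^'m^'n) set).
         lyapunov c \<epsilon> \<mu>\<^sub>1 \<mu>\<^sub>2 (relaxed (row_proj \<mu>\<^sub>1) (row_Theta \<theta>\<^sub>0 \<delta> \<mu>\<^sub>1 \<gamma>) \<gamma>)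
           \<le> lyapunov c \<epsilon> \<mu>\<^sub>1 \<mu>\<^sub>2 \<gamma> \<and>
         (\<gamma> \<notin> row_constraint \<mu>\<^sub>1 \<longrightarrow>
           lyapunov c \<epsilon> \<mu>\<^sub>1 \<mu>\<^sub>2 (relaxed (row_proj \<mu>\<^sub>1) (row_Theta \<theta>\<^sub>0 \<delta> \<mu>\<^sub>1 \<gamma>) \<gamma>)
             < lyapunov c \<epsilon> \<mu>\<^sub>1 \<mu>\<^sub>2 \<gamma>)))
     \<and>
     (continuous_on pos_mats (col_Theta \<theta>\<^sub>0 \<delta> \<mu>\<^sub>2 :: real^'m^'n \<Rightarrow> real) \<and>
      (\<forall>\<gamma> \<in> (pos_mats :: (real^'m^'n) set).
         lyapunov c \<epsilon> \<mu>\<^sub>1 \<mu>\<^sub>2 (relaxed (col_proj \<mu>\<^sub>2) (col_Theta \<theta>\<^sub>0 \<delta> \<mu>\<^sub>2 \<gamma>) \<gamma>)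
           \<le> lyapunov c \<epsilon> \<mu>\<^sub>1 \<mu>\<^sub>2 \<gamma> \<and>
         (\<gamma> \<notin> col_constraint \<mu>\<^sub>2 \<longrightarrow>
           lyapunov c \<epsilon> \<mu>\<^sub>1 \<mu>\<^sub>2 (relaxed (col_proj \<mu>\<^sub>2) (col_Theta \<theta>\<^sub>0 \<delta> \<mu>\<^sub>2 \<gamma>) \<gamma>)
             < lyapunov c \<epsilon> \<mu>\<^sub>1 \<mu>\<^sub>2 \<gamma>)))"
proof -
  define \<eta> where "\<eta> = optimal_plan c \<epsilon> \<mu>\<^sub>1 \<mu>\<^sub>2"
  \<comment> \<open>Unique existence makes the definite description an actual minimizer, hence
    feasible.\<close>
  have "is_optimal_plan c \<epsilon> \<mu>\<^sub>1 \<mu>\<^sub>2 \<eta>"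
    unfolding \<eta>_def optimal_plan_def by (rule theI'[OF ex1_optimal_plan[OF assms(4,1,2)]])
  then have \<eta>: "\<eta> \<in> nonneg_mats" "\<eta> \<in> row_constraint \<mu>\<^sub>1" "\<eta> \<in> col_constraint \<mu>\<^sub>2"
    by (auto simp: is_optimal_plan_def is_arg_min_def)
  show ?thesis
    unfolding lyapunov_def \<eta>_def[symmetric]
    by (intro conjI[OF conjI conjI] ballI continuous_on_row_Theta continuous_on_col_Theta
        row_descent col_descent \<eta> assms)
qed

end
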